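(* Let $\omega>0$, $p_0>0$, let $V$ be a real vector space with basis $e_1,e_2,e_3$, and let $q=q(t)$, $p=p(t)$ be the solution of $\dot q=p$, $\dot p=-\omega^2q$ with $q(0)=0$, $p(0)=p_0$. Let $A_\pm=A_\pm(t)$ be real-valued functions with $A_+^2+A_-^2=2\sqrt{2H}$, $A_+^2-A_-^2=2p$, $A_+A_-=\omega q$, where $H=\tfrac12(p^2+\omega^2q^2)$, and $A_+(0)=\sqrt{2p_0}$, $A_-(0)=0$. Then for every $t$ each of the following bilinear anti-commutative brackets $[\cdot,\cdot]_t$ on $V$ satisfies the Jacobi identity, i.e. makes $V$ a Lie algebra: (II$^t$) $[e_1,e_2]_t=0$, $[e_2,e_3]_t=\frac{p+p_0}{2p_0}e_1+\frac{\omega q}{2p_0}e_2$, $[e_3,e_1]_t=\frac{\omega q}{2p_0}e_1-\frac{p-p_0}{2p_0}e_2$; (IV$^t$) $[e_1,e_2]_t=\frac{A_-}{\sqrt{2p_0}}e_1-\frac{A_+}{\sqrt{2p_0}}e_2+e_3$, $[e_2,e_3]_t=-\frac{A_-}{\sqrt{2p_0}}e_3$, $[e_3,e_1]_t=\frac{A_+}{\sqrt{2p_0}}e_3$; (V$^t$) $[e_1,e_2]_t=\frac{A_-}{\sqrt{2p_0}}e_1-\frac{A_+}{\sqrt{2p_0}}e_2$, $[e_2,e_3]_t=-\frac{A_-}{\sqrt{2p_0}}e_3$, $[e_3,e_1]_t=\frac{A_+}{\sqrt{2p_0}}e_3$; (VI$^t$) $[e_1,e_2]_t=0$, $[e_2,e_3]_t=\frac{p}{p_0}e_1+\frac{\omega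 q}{p_0}e_2$, $[e_3,e_1]_t=\frac{\omega q}{p_0}e_1-\frac{p}{p_0}e_2$; (VII$_a^t$, for every real $a>0$) $[e_1,e_2]_t=\frac{aA_-}{\sqrt{2p_0}}e_1-\frac{aA_+}{\sqrt{2p_0}}e_2+e_3$, $[e_2,e_3]_t=-\frac{p-p_0}{2p_0}e_1-\frac{\omega q}{2p_0}e_2-\frac{aA_-}{\sqrt{2p_0}}e_3$, $[e_3,e_1]_t=-\frac{\omega q}{2p_0}e_1+\frac{p+p_0}{2p_0}e_2+\frac{aA_+}{\sqrt{2p_0}}e_3$; (III$_{a=1}^t$) $[e_1,e_2]_t=\frac{A_-}{\sqrt{2p_0}}e_1-\frac{A_+}{\sqrt{2p_0}}e_2-e_3$, $[e_2,e_3]_t=-\frac{p-p_0}{2p_0}e_1-\frac{\omega q}{2p_0}e_2-\frac{A_-}{\sqrt{2p_0}}e_3$, $[e_3,e_1]_t=-\frac{\omega q}{2p_0}e_1+\frac{p+p_0}{2p_0}e_2+\frac{A_+}{\sqrt{2p_0}}e_3$; (VI$_{a\neq1}^t$, for every real $a>0$, $a\neq1$) $[e_1,e_2]_t=\frac{aA_-}{\sqrt{2p_0}}e_1-\frac{aA_+}{\sqrt{2p_0}}e_2-e_3$, $[e_2,e_3]_t=-\frac{p-p_0}{2p_0}e_1-\frac{\omega q}{2p_0}e_2-\frac{aA_-}{\sqrt{2p_0}}e_3$, $[e_3,e_1]_t=-\frac{\omega q}{2p_0}e_1+\frac{p+p_0}{2p_0}e_2+\frac{aA_+}{\sqrt{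2p_0}}e_3$.
   Context: Here $q,p$ are the canonical variables of the harmonic oscillator with Hamiltonian $H(q,p)=\tfrac12(p^2+\omega^2q^2)$ and total energy $E=p_0^2/2$, so $p_0=\sqrt{2E}$. The listed brackets are the dynamical deformations over the harmonic oscillator of the three-dimensional real Lie algebras of Bianchi types II, IV, V, VI, VII$_a$, III$_{a=1}$, VI$_{a\neq1}$, which are recovered at $t=0$. The Jacobi identity for $[\cdot,\cdot]_t$ is $J_t(x;y;z):=[x,[y,z]_t]_t+[y,[z,x]_t]_t+[z,[x,y]_t]_t=0$ for all $x,y,z\in V$. *)

theory Defs
  imports "HOL-Analysis.Analysis"
begin

definition hamiltonian :: "real \<Rightarrow> real \<Rightarrow> real \<Rightarrow> real" where
  "hamiltonian \<omega> q p = (p\<^sup>2 + \<omega>\<^sup>2 * q\<^sup>2) / 2"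

definition is_basis3 :: "'v::real_vector \<Rightarrow> 'v \<Rightarrow> 'v \<Rightarrow> bool" where
  "is_basis3 e1 e2 e3 \<longleftrightarrow>
     distinct [e1, e2, e3] \<and> independent {e1, e2, e3} \<and> span {e1, e2, e3} = UNIV"

definition jacobiator :: "('v::real_vector \<Rightarrow> 'v \<Rightarrow> 'v) \<Rightarrow> 'v \<Rightarrow> 'v \<Rightarrow> 'v \<Rightarrow> 'v" where
  "jacobiator B x y z = B x (B y z) + B y (B z x) + B z (B x y)"

definition anticommutative_bracket :: "('v::real_vector \<Rightarrow> 'v \<Rightarrow> 'v) \<Rightarrow> bool" where
  "anticommutative_bracket B \<longleftrightarrow> bilinear B \<and> (\<forall>x y. B x y = - B y x)"

definition lie_bracket :: "('v::real_vector \<Rightarrow> 'v \<Rightarrow> 'v) \<Rightarrow> bool" where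
  "lie_bracket B \<longleftrightarrow> anticommutative_bracket B \<and> (\<forall>x y z. jacobiator B x y z = 0)"

text \<open>The bilinear anti-commutative bracket with \<open>[e1, e2] = w12\<close>, \<open>[e2, e3] = w23\<close> and
  \<open>[e3, e1] = w31\<close>; note the cyclic order of the last pair. That it is the only such bracket
  when \<open>e1, e2, e3\<close> is a basis is \<open>bracket_of_unique\<close> below.\<close>

definition bracket_of ::
    "'v::real_vector \<Rightarrow> 'v \<Rightarrow> 'v \<Rightarrow> 'v \<Rightarrow> 'v \<Rightarrow> 'v \<Rightarrow> 'v \<Rightarrow> 'v \<Rightarrow> 'v" where
  "bracket_of e1 e2 e3 w12 w23 w31 x y =
     (let c = representation {e1, e2, e3} in
        (c x e1 * c y e2 - c x e2 * c y e1) *\<^sub>R w12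
      + (c x e2 * c y e3 - c x e3 * c y e2) *\<^sub>R w23
      + (c x e3 * c y e1 - c x e1 * c y e3) *\<^sub>R w31)"

lemma bracket_of_anticommutative:
  assumes "is_basis3 e1 e2 e3"
  shows "anticommutative_bracket (bracket_of e1 e2 e3 w12 w23 w31)"
proof -
  have ind: "independent {e1, e2, e3}" and sp: "span {e1, e2, e3} = UNIV"
    using assms by (auto simp: is_basis3_def)
  have add: "representation {e1, e2, e3} (x + y) b
      = representation {e1, e2, e3} x b + representation {e1, e2, e3} y b" for x y b
    using real_vector.representation_add[OF ind, of y x] sp by simp
  have scale: "representation {e1, e2, e3} (r *\<^sub>R x) b
      = r * representation {e1, e2, e3} x b" for r x b
    using real_vector.representation_scale[OF ind, of x r] sp by simp
  show ?thesis
    unfolding anticommutative_bracket_def bilinear_def linear_iff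
    by (auto simp: bracket_of_def Let_def add scale algebra_simps)
qed

lemma bracket_of_basis:
  assumes "is_basis3 e1 e2 e3"
  shows "bracket_of e1 e2 e3 w12 w23 w31 e1 e2 = w12"
    and "bracket_of e1 e2 e3 w12 w23 w31 e2 e3 = w23"
    and "bracket_of e1 e2 e3 w12 w23 w31 e3 e1 = w31"
proof -
  have ind: "independent {e1, e2, e3}" and d: "e1 \<noteq> e2" "e1 \<noteq> e3" "e2 \<noteq> e3"
    using assms by (auto simp: is_basis3_def)
  have r: "representation {e1, e2, e3} b = (\<lambda>v. if v = b then 1 else 0)"
    if "b \<in> {e1, e2, e3}" for b
    by (rule real_vector.representation_basis[OF ind that])
  show "bracket_of e1 e2 e3 w12 w23 w31 e1 e2 = w12"
    "bracket_of e1 e2 e3 w12 w23 w31 e2 e3 = w23"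
    "bracket_of e1 e2 e3 w12 w23 w31 e3 e1 = w31"
    using d by (auto simp: bracket_of_def Let_def r)
qed

lemma bracket_of_unique:
  assumes basis: "is_basis3 e1 e2 e3" and B: "anticommutative_bracket B"
    and "B e1 e2 = w12" "B e2 e3 = w23" "B e3 e1 = w31"
  shows "B = bracket_of e1 e2 e3 w12 w23 w31"
proof -
  let ?C = "bracket_of e1 e2 e3 w12 w23 w31"
  have C: "anticommutative_bracket ?C" by (rule bracket_of_anticommutative[OF basis])
  have anti: "D x y = - D y x" if "anticommutative_bracket D" for D and x y :: 'a
    using that unfolding anticommutative_bracket_def by blast
  have self: "D x x = 0" if "anticommutative_bracket D" for D and x :: 'a
  proof -
    have "2 *\<^sub>R D x x = 0"
      using anti[OF that, of x x] by (metis add.right_inverse scaleR_2)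
    then show ?thesis by simp
  qed
  have cyc: "B e1 e2 = ?C e1 e2" "B e2 e3 = ?C e2 e3" "B e3 e1 = ?C e3 e1"
    by (simp_all only: bracket_of_basis[OF basis] assms(3-5))
  have rev: "B e2 e1 = ?C e2 e1" "B e3 e2 = ?C e3 e2" "B e1 e3 = ?C e1 e3"
    using cyc anti[OF B, of e2 e1] anti[OF B, of e3 e2] anti[OF B, of e1 e3]
      anti[OF C, of e2 e1] anti[OF C, of e3 e2] anti[OF C, of e1 e3]
    by (simp_all only:)
  have eq: "B x y = ?C x y" if "x \<in> {e1, e2, e3}" "y \<in> {e1, e2, e3}" for x y
    using that cyc rev self[OF B] self[OF C] by (elim insertE emptyE) (simp_all only:)
  have sp: "span {e1, e2, e3} = UNIV" using basis by (simp add: is_basis3_def)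
  have bil: "bilinear B" "bilinear ?C"
    using B C by (simp_all only: anticommutative_bracket_def)
  show ?thesis
  proof (intro ext)
    fix x y
    show "B x y = ?C x y"
      by (rule bilinear_eq[OF bil, of UNIV "{e1, e2, e3}" UNIV "{e1, e2, e3}"])
        (simp_all only: sp UNIV_I order_refl eq)
  qed
qed

end

theory Submission
  imports Defs
begin

text \<open>In coordinates, the Jacobiator of a bracket on a three-dimensional space is the
  determinant of its arguments times the Jacobiator of the basis, so the Jacobi identity is one
  vector equation. Conservation of energy gives \<open>Ap\<^sup>2 + Am\<^sup>2 = 2 p0\<close>, hence all the structure
  constants are polynomials in \<open>u = Am / sqrt (2 p0)\<close> and \<open>v = Ap / sqrt (2 p0)\<close>, and the vector
  equation becomes a polynomial identity.\<close>

text \<open>The left side of \<open>jacobi\<close> is the Jacobiator of \<open>e1\<close>,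
  \<open>e2\<close>, \<open>e3\<close>: the inner brackets give \<open>b2 * w12 - b3 * w31\<close>,
  \<open>c3 * w23 - c1 * w12\<close> and \<open>a1 * w31 - a2 * w23\<close>.\<close>

lemma lie_bracket_bracket_of:
  fixes e1 e2 e3 :: "'v::real_vector"
  assumes basis: "is_basis3 e1 e2 e3"
    and w12: "w12 = a1 *\<^sub>R e1 + a2 *\<^sub>R e2 + a3 *\<^sub>R e3"
    and w23: "w23 = b1 *\<^sub>R e1 + b2 *\<^sub>R e2 + b3 *\<^sub>R e3"
    and w31: "w31 = c1 *\<^sub>R e1 + c2 *\<^sub>R e2 + c3 *\<^sub>R e3"
    and jacobi: "(b2 - c1) *\<^sub>R w12 + (c3 - a2) *\<^sub>R w23 + (a1 - b3) *\<^sub>R w31 = 0"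
  shows "lie_bracket (bracket_of e1 e2 e3 w12 w23 w31)"
proof -
  let ?B = "bracket_of e1 e2 e3 w12 w23 w31"
  define r where "r = representation {e1, e2, e3}"
  have ind: "independent {e1, e2, e3}" and sp: "span {e1, e2, e3} = UNIV"
    and d: "e1 \<noteq> e2" "e1 \<noteq> e3" "e2 \<noteq> e3"
    using basis by (auto simp: is_basis3_def)
  have add: "r (x + y) b = r x b + r y b" for x y b
    unfolding r_def using real_vector.representation_add[OF ind, of y x] sp by simp
  have scale: "r (k *\<^sub>R x) b = k * r x b" for k x b
    unfolding r_def using real_vector.representation_scale[OF ind, of x k] sp by simp
  have base: "r b = (\<lambda>v. if v = b then 1 else 0)" if "b \<in> {e1, e2, e3}" for b
    unfolding r_def by (rule real_vector.representation_basis[OF ind that])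
  have coords:
    "r w12 e1 = a1" "r w12 e2 = a2" "r w12 e3 = a3"
    "r w23 e1 = b1" "r w23 e2 = b2" "r w23 e3 = b3"
    "r w31 e1 = c1" "r w31 e2 = c2" "r w31 e3 = c3"
    using d by (auto simp: w12 w23 w31 add scale base)
  have B: "?B x y = (r x e1 * r y e2 - r x e2 * r y e1) *\<^sub>R w12
      + (r x e2 * r y e3 - r x e3 * r y e2) *\<^sub>R w23
      + (r x e3 * r y e1 - r x e1 * r y e3) *\<^sub>R w31" for x y
    by (simp add: bracket_of_def Let_def r_def)
  have jac: "jacobiator ?B x y z = 0" for x y z
  proof -
    \<comment> \<open>The determinant of the coordinates of \<open>x\<close>, \<open>y\<close>,
      \<open>z\<close>.\<close>
    define D where "D = r x e1 * (r y e2 * r z e3 - r y e3 * r z e2)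
      + r x e2 * (r y e3 * r z e1 - r y e1 * r z e3)
      + r x e3 * (r y e1 * r z e2 - r y e2 * r z e1)"
    \<comment> \<open>Splits the vector equation into three scalar ones, matching the coefficients
      of \<open>w12\<close>, \<open>w23\<close> and \<open>w31\<close> separately.\<close>
    have collect: "(k *\<^sub>R w12 + l *\<^sub>R w23 + m *\<^sub>R w31) + (k' *\<^sub>R w12 + l' *\<^sub>R w23 + m' *\<^sub>R w31)
        + (k'' *\<^sub>R w12 + l'' *\<^sub>R w23 + m'' *\<^sub>R w31)
      = D *\<^sub>R ((b2 - c1) *\<^sub>R w12 + (c3 - a2) *\<^sub>R w23 + (a1 - b3) *\<^sub>R w31)"
      if "k + k' + k'' = D * (b2 - c1)" "l + l' + l'' = D * (c3 - a2)"
        "m + m' + m'' = D * (a1 - b3)" for k k' k'' l l' l'' m m' m''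
      by (simp only: scaleR_add_right scaleR_scaleR that[symmetric]) (simp add: algebra_simps)
    have "jacobiator ?B x y z
      = D *\<^sub>R ((b2 - c1) *\<^sub>R w12 + (c3 - a2) *\<^sub>R w23 + (a1 - b3) *\<^sub>R w31)"
      \<comment> \<open>Only the outer brackets are expanded here, which gives the shape of
        \<open>collect\<close>; the inner ones are expanded later, inside their coordinates.\<close>
      unfolding jacobiator_def B[of x "?B y z"] B[of y "?B z x"] B[of z "?B x y"]
      by (rule collect; simp only: B add scale coords D_def; algebra)
    then show ?thesis by (simp add: jacobi)
  qed
  then show ?thesis
    by (simp add: lie_bracket_def bracket_of_anticommutative[OF basis])
qed

text \<open>Serves types II and VI: the shared entry \<open>y\<close> gives \<open>b2 = c1\<close>,
  and the other entries of the Jacobi equation's coefficients are 0, so all three coefficients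
  vanish.\<close>

lemma lie_bracket_symmetric:
  fixes e1 e2 e3 :: "'v::real_vector"
  assumes "is_basis3 e1 e2 e3"
    and "w23 = x *\<^sub>R e1 + y *\<^sub>R e2" and "w31 = y *\<^sub>R e1 + z *\<^sub>R e2"
  shows "lie_bracket (bracket_of e1 e2 e3 0 w23 w31)"
  by (rule lie_bracket_bracket_of[where ?a1.0 = 0 and ?a2.0 = 0 and ?a3.0 = 0
        and ?b1.0 = x and ?b2.0 = y and ?b3.0 = 0 and ?c1.0 = y and ?c2.0 = z and ?c3.0 = 0])
    (simp_all add: assms)

text \<open>Types IV and V have \<open>d = 0\<close>, the types VII, III and VI have \<open>d = 1\<close>; the coefficient of
  \<open>e3\<close> in \<open>[e1, e2]\<close> is free because the Jacobi identity multiplies it by \<open>b2 - c1 = 0\<close>.\<close>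

lemma lie_bracket_nonunimodular:
  fixes e1 e2 e3 :: "'v::real_vector"
  assumes "is_basis3 e1 e2 e3"
    and "w12 = (a * u) *\<^sub>R e1 - (a * v) *\<^sub>R e2 + c *\<^sub>R e3"
    and "w23 = (d * u\<^sup>2) *\<^sub>R e1 - (d * (u * v)) *\<^sub>R e2 - (a * u) *\<^sub>R e3"
    and "w31 = - (d * (u * v)) *\<^sub>R e1 + (d * v\<^sup>2) *\<^sub>R e2 + (a * v) *\<^sub>R e3"
  shows "lie_bracket (bracket_of e1 e2 e3 w12 w23 w31)"
  \<comment> \<open>With \<open>b2 = c1\<close>, \<open>c3 - a2 = 2 * a * v\<close> and
    \<open>a1 - b3 = 2 * a * u\<close>, what remains is \<open>2 * a\<close> times
    \<open>v * w23 + u * w31\<close>, whose terms cancel in pairs.\<close>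
  by (rule lie_bracket_bracket_of[where ?a1.0 = "a * u" and ?a2.0 = "- (a * v)" and ?a3.0 = c
        and ?b1.0 = "d * u\<^sup>2" and ?b2.0 = "- (d * (u * v))" and ?b3.0 = "- (a * u)"
        and ?c1.0 = "- (d * (u * v))" and ?c2.0 = "d * v\<^sup>2" and ?c3.0 = "a * v"])
    (simp_all add: assms algebra_simps power2_eq_square)

lemma hamiltonian_conserved:
  fixes q p :: "real \<Rightarrow> real"
  assumes "\<And>t. (q has_real_derivative p t) (at t)"
    and "\<And>t. (p has_real_derivative - (\<omega>\<^sup>2 * q t)) (at t)"
  shows "hamiltonian \<omega> (q t) (p t) = hamiltonian \<omega> (q 0) (p 0)"
proof -
  \<comment> \<open>The contributions of \<open>p\<close> and \<open>q\<close> to the derivative are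
    opposite multiples of \<open>p t * q t\<close>.\<close>
  have "((\<lambda>t. hamiltonian \<omega> (q t) (p t)) has_real_derivative 0) (at t)" for t
    unfolding hamiltonian_def
    by (rule derivative_eq_intros assms refl | simp)+
  then show ?thesis using DERIV_isconst_all by blast
qed

theorem theorem8p2:
  fixes \<omega> p0 :: real
    and e1 e2 e3 :: "'v::real_vector"
    and q p Ap Am :: "real \<Rightarrow> real"
  assumes "\<omega> > 0" and "p0 > 0"
    and "is_basis3 e1 e2 e3"
    and "\<And>t. (q has_real_derivative p t) (at t)"
    and "\<And>t. (p has_real_derivative - (\<omega>\<^sup>2 * q t)) (at t)"
    and "q 0 = 0" and "p 0 = p0"
    and "\<And>t. (Ap t)\<^sup>2 + (Am t)\<^sup>2 = 2 * sqrt (2 * hamiltonian \<omega> (q t) (p t))"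
    and "\<And>t. (Ap t)\<^sup>2 - (Am t)\<^sup>2 = 2 * p t"
    and "\<And>t. Ap t * Am t = \<omega> * q t"
    and "Ap 0 = sqrt (2 * p0)" and "Am 0 = 0"
  shows
    "\<forall>t.
      \<comment> \<open>II\<close>
      lie_bracket (bracket_of e1 e2 e3
        0
        (((p t + p0) / (2 * p0)) *\<^sub>R e1 + ((\<omega> * q t) / (2 * p0)) *\<^sub>R e2)
        (((\<omega> * q t) / (2 * p0)) *\<^sub>R e1 - ((p t - p0) / (2 * p0)) *\<^sub>R e2))
    \<and> \<comment> \<open>IV\<close>
      lie_bracket (bracket_of e1 e2 e3
        ((Am t / sqrt (2 * p0)) *\<^sub>R e1 - (Ap t / sqrt (2 * p0)) *\<^sub>R e2 + e3)
        (- ((Am t / sqrt (2 * p0)) *\<^sub>R e3))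
        ((Ap t / sqrt (2 * p0)) *\<^sub>R e3))
    \<and> \<comment> \<open>V\<close>
      lie_bracket (bracket_of e1 e2 e3
        ((Am t / sqrt (2 * p0)) *\<^sub>R e1 - (Ap t / sqrt (2 * p0)) *\<^sub>R e2)
        (- ((Am t / sqrt (2 * p0)) *\<^sub>R e3))
        ((Ap t / sqrt (2 * p0)) *\<^sub>R e3))
    \<and> \<comment> \<open>VI\<close>
      lie_bracket (bracket_of e1 e2 e3
        0
        ((p t / p0) *\<^sub>R e1 + ((\<omega> * q t) / p0) *\<^sub>R e2)
        (((\<omega> * q t) / p0) *\<^sub>R e1 - (p t / p0) *\<^sub>R e2))
    \<and> \<comment> \<open>VII_a\<close>
      (\<forall>a::real. a > 0 \<longrightarrow> lie_bracket (bracket_of e1 e2 e3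
        (((a * Am t) / sqrt (2 * p0)) *\<^sub>R e1 - ((a * Ap t) / sqrt (2 * p0)) *\<^sub>R e2 + e3)
        (- (((p t - p0) / (2 * p0)) *\<^sub>R e1) - ((\<omega> * q t) / (2 * p0)) *\<^sub>R e2
           - ((a * Am t) / sqrt (2 * p0)) *\<^sub>R e3)
        (- (((\<omega> * q t) / (2 * p0)) *\<^sub>R e1) + ((p t + p0) / (2 * p0)) *\<^sub>R e2
           + ((a * Ap t) / sqrt (2 * p0)) *\<^sub>R e3)))
    \<and> \<comment> \<open>III_{a=1}\<close>
      lie_bracket (bracket_of e1 e2 e3
        ((Am t / sqrt (2 * p0)) *\<^sub>R e1 - (Ap t / sqrt (2 * p0)) *\<^sub>R e2 - e3)
        (- (((p t - p0) / (2 * p0)) *\<^sub>R e1) - ((\<omega> * q t) / (2 * p0)) *\<^sub>R e2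
           - (Am t / sqrt (2 * p0)) *\<^sub>R e3)
        (- (((\<omega> * q t) / (2 * p0)) *\<^sub>R e1) + ((p t + p0) / (2 * p0)) *\<^sub>R e2
           + (Ap t / sqrt (2 * p0)) *\<^sub>R e3))
    \<and> \<comment> \<open>VI_{a\<noteq>1}\<close>
      (\<forall>a::real. a > 0 \<and> a \<noteq> 1 \<longrightarrow> lie_bracket (bracket_of e1 e2 e3
        (((a * Am t) / sqrt (2 * p0)) *\<^sub>R e1 - ((a * Ap t) / sqrt (2 * p0)) *\<^sub>R e2 - e3)
        (- (((p t - p0) / (2 * p0)) *\<^sub>R e1) - ((\<omega> * q t) / (2 * p0)) *\<^sub>R e2
           - ((a * Am t) / sqrt (2 * p0)) *\<^sub>R e3)
        (- (((\<omega> * q t) / (2 * p0)) *\<^sub>R e1) + ((p t + p0) / (2 * p0)) *\<^sub>R e2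
           + ((a * Ap t) / sqrt (2 * p0)) *\<^sub>R e3)))" (is "\<forall>t. ?P t")
proof
  fix t
  define s where "s = sqrt (2 * p0)"
  define u where "u = Am t / s"
  define v where "v = Ap t / s"
  have s2: "s\<^sup>2 = 2 * p0" using \<open>p0 > 0\<close> by (simp add: s_def)
  \<comment> \<open>At time 0 the energy is \<open>p0\<^sup>2 / 2\<close>.\<close>
  have "2 * hamiltonian \<omega> (q t) (p t) = p0\<^sup>2"
    using hamiltonian_conserved[of q p \<omega> t] assms(4-7) by (simp add: hamiltonian_def)
  then have "sqrt (2 * hamiltonian \<omega> (q t) (p t)) = p0"
    using \<open>p0 > 0\<close> by simp
  \<comment> \<open>Half the sum and half the difference of the two relations between the
    squares.\<close>
  then have "(Ap t)\<^sup>2 = p t + p0" and "(Am t)\<^sup>2 = - (p t - p0)"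
    using assms(8,9)[of t] by linarith+
  then have v2: "(p t + p0) / (2 * p0) = v\<^sup>2" and u2: "(p t - p0) / (2 * p0) = - u\<^sup>2"
    by (simp_all add: u_def v_def power_divide s2 diff_divide_distrib)
  have uv: "(\<omega> * q t) / (2 * p0) = u * v"
    using assms(10)[of t] s2 by (simp add: u_def v_def power2_eq_square mult.commute)
  have au: "a * Am t / sqrt (2 * p0) = a * u" and av: "a * Ap t / sqrt (2 * p0) = a * v" for a
    by (simp_all add: u_def v_def s_def)
  have u: "Am t / sqrt (2 * p0) = u" and v: "Ap t / sqrt (2 * p0) = v"
    by (simp_all add: u_def v_def s_def)
  note sym = lie_bracket_symmetric[OF \<open>is_basis3 e1 e2 e3\<close>]
  note nonuni = lie_bracket_nonunimodular[OF \<open>is_basis3 e1 e2 e3\<close>, where u = u and v = v]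
  show "?P t"
    unfolding au av u v
  proof (intro conjI allI impI, goal_cases)
    case 1
    show ?case
      \<comment> \<open>The bracket subtracts its \<open>e2\<close> term, so \<open>z\<close>
        carries the minus sign.\<close>
      by (rule sym[where x = "(p t + p0) / (2 * p0)" and y = "\<omega> * q t / (2 * p0)"
            and z = "- ((p t - p0) / (2 * p0))"]) simp_all
  next
    case 2
    show ?case
      by (rule nonuni[where a = 1 and c = 1 and d = 0]) simp_all
  next
    case 3
    show ?case
      by (rule nonuni[where a = 1 and c = 0 and d = 0]) simp_all
  next
    case 4
    show ?case
      by (rule sym[where x = "p t / p0" and y = "\<omega> * q t / p0" and z = "- (p t / p0)"]) simp_all
  next
    case (5 a)
    show ?case
      \<comment> \<open>The sign of \<open>e3\<close> in the first bracket fixes \<open>c\<close>: 1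
        here, -1 for types III and VI with parameter \<open>a\<close>.\<close>
      by (rule nonuni[where a = a and c = 1 and d = 1]) (simp_all add: u2 v2 uv)
  next
    case 6
    show ?case
      by (rule nonuni[where a = 1 and c = "- 1" and d = 1]) (simp_all add: u2 v2 uv)
  next
    case (7 a)
    show ?case
      by (rule nonuni[where a = a and c = "- 1" and d = 1]) (simp_all add: u2 v2 uv)
  qed
qed

end
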